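(* Let $0<q<p\le\infty$ with $q\le 2$. Then for every integer $n\ge 1$ and every $f\in\mathcal{T}_n$, $$\|f\|_{L_p[0,1]} \le \left(\frac{\pi n}{2}\right)^{2/q-2/p}\|f\|_{L_q[0,1]}.$$
   Context: For an integer $n\ge1$, $\mathcal{T}_n$ denotes the set of all functions $f:\mathbb{R}\to\mathbb{C}$ of the form $f(t)=\sum_{j=1}^n a_j e^{i\lambda_j t}$ with $a_j\in\mathbb{C}$ (possibly zero) and real exponents $\lambda_1<\lambda_2<\cdots<\lambda_n$. For $0<r<\infty$, $\|f\|_{L_r[0,1]}:=(\int_0^1|f(t)|^r\,dt)^{1/r}$, and $\|f\|_{L_\infty[0,1]}:=\sup_{t\in[0,1]}|f(t)|$. *)

theory Defs
  imports "HOL-Analysis.Analysis"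
begin

definition exp_sums :: "nat \<Rightarrow> (real \<Rightarrow> complex) set" where
  "exp_sums n = {f. \<exists>(a::nat \<Rightarrow> complex) (lam::nat \<Rightarrow> real).
      (\<forall>i j. i < j \<longrightarrow> j < n \<longrightarrow> lam i < lam j) \<and>
      f = (\<lambda>t. \<Sum>j<n. a j * exp (\<i> * complex_of_real (lam j * t)))}"

definition Lr_norm01 :: "real \<Rightarrow> (real \<Rightarrow> complex) \<Rightarrow> real" where
  "Lr_norm01 r f = (LBINT t=0..1. norm (f t) powr r) powr (1 / r)"

definition Linf_norm01 :: "(real \<Rightarrow> complex) \<Rightarrow> real" where
  "Linf_norm01 f = (SUP t\<in>{0..1}. norm (f t))"

definition Lp_norm01 :: "ereal \<Rightarrow> (real \<Rightarrow> complex) \<Rightarrow> real" where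
  "Lp_norm01 p f = (if p = \<infinity> then Linf_norm01 f else Lr_norm01 (real_of_ereal p) f)"

definition inv_exp :: "ereal \<Rightarrow> real" where
  "inv_exp p = (if p = \<infinity> then 0 else 1 / real_of_ereal p)"

end

theory Submission
  imports Defs "HOL-Computational_Algebra.Polynomial" "HOL-Real_Asymp.Real_Asymp"
begin

text \<open>
  The heart of the matter is $|f(0)|^2 \le (\pi n/2)^2 \int_0^1 |f|^2$. Let $G$ be the upper left
  entry of $R D(z) R \cdots D(z) R$, where $R$ is the rotation by $\pi/(2m)$, occurring $m = N + 1$
  times, and $D(z) = \mathrm{diag}(1, z)$. It has degree at most $N$; at $z = 1$ the rotations add up
  to a right angle, so $G(1) = 0$, and $G(0) = \cos(\pi/(2m))^m$. Since all factors are unitary for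
  $|z| = 1$, multiplication by $G$ does not increase the $\ell^2$ norm of the coefficients of a
  polynomial. Multiplying together $n$ rotated copies of $G$, one for each frequency, gives a
  polynomial of degree at most $nN$ whose coefficients $d_k$ annihilate the samples $f(k/(nN))$, with
  $\sum_k |d_k|^2 \le 1$ and $d_0 = \cos(\pi/(2m))^{mn}$. By Cauchy--Schwarz
  $d_0^2 |f(0)|^2 \le (1 - d_0^2) \sum_{k=1}^{nN} |f(k/(nN))|^2$, and $N \to \infty$ turns the sum
  into an integral. Rescaling to $[0, y]$ and $[y, 1]$ and adding gives the same bound for $|f(y)|^2$.
  Finally $|f|^r \le \|f\|_\infty^{r-q} |f|^q$ is used with $r = 2$ to pass from the exponent $2$ to
  $q$, and with $r = p$ to pass from $\infty$ to $p$.
\<close>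

section \<open>Products of rotations and shifts as polynomials\<close>

text \<open>The first column of $R D(w z) R \cdots D(w z) R$ with $k + 1$ factors $R$, multiplied by \<open>P\<close>.\<close>

fun rotor :: "real \<Rightarrow> complex \<Rightarrow> complex poly \<Rightarrow> nat \<Rightarrow> complex poly \<times> complex poly" where
  "rotor \<alpha> w P 0 = (smult (cos (of_real \<alpha>)) P, smult (sin (of_real \<alpha>)) P)"
| "rotor \<alpha> w P (Suc k) = (case rotor \<alpha> w P k of (A, B) \<Rightarrow>
     (smult (cos (of_real \<alpha>)) A - smult (sin (of_real \<alpha>)) (pCons 0 (smult w B)),
      smult (sin (of_real \<alpha>)) A + smult (cos (of_real \<alpha>)) (pCons 0 (smult w B))))"

lemma norm_rotation:
  fixes a b :: complex
  shows "(cmod (cos (of_real \<alpha>) * a - sin (of_real \<alpha>) * b))\<^sup>2 + (cmod (sin (of_real \<alpha>) * a + cos (of_real \<alpha>) * b))\<^sup>2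
    = (cmod a)\<^sup>2 + (cmod b)\<^sup>2"
proof -
  define c s where "c = cos \<alpha>" and "s = sin \<alpha>"
  have 1: "c\<^sup>2 + s\<^sup>2 = 1" by (simp add: c_def s_def)
  have "(cmod (of_real c * a - of_real s * b))\<^sup>2 + (cmod (of_real s * a + of_real c * b))\<^sup>2
     = (c\<^sup>2 + s\<^sup>2) * ((cmod a)\<^sup>2 + (cmod b)\<^sup>2)"
    by (simp add: cmod_power2) algebra
  then show ?thesis by (simp add: 1 c_def s_def cos_of_real sin_of_real)
qed

lemma rotor_degree:
  assumes "degree P \<le> d"
  shows "degree (fst (rotor \<alpha> w P k)) \<le> d + k \<and> degree (snd (rotor \<alpha> w P k)) \<le> d + k"
proof (induction k)
  case 0
  then show ?case using assms by (auto intro: order.trans[OF degree_smult_le])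
next
  case (Suc k)
  obtain A B where AB: "rotor \<alpha> w P k = (A, B)" by (cases "rotor \<alpha> w P k")
  have A: "degree (smult x A) \<le> d + Suc k" for x
    using Suc AB degree_smult_le[of x A] by simp
  have "degree (pCons 0 (smult w B)) \<le> d + Suc k"
    using Suc AB degree_smult_le[of w B] degree_pCons_le[of 0 "smult w B"] by simp
  then have B: "degree (smult x (pCons 0 (smult w B))) \<le> d + Suc k" for x
    using degree_smult_le order.trans by blast
  show ?case
    using A B by (simp add: AB degree_add_le degree_diff_le del: smult_pCons)
qed

text \<open>Divisibility by \<open>P\<close> keeps the zeros already gained, so the points can be
  treated one after another.\<close>

lemma rotor_dvd: "P dvd fst (rotor \<alpha> w P k) \<and> P dvd snd (rotor \<alpha> w P k)"
proof (induction k)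
  case (Suc k)
  obtain A B where AB: "rotor \<alpha> w P k = (A, B)" by (cases "rotor \<alpha> w P k")
  have "P dvd pCons 0 (smult w B)" 
    using Suc AB dvd_mult[of P "smult w B" "[:0, 1:]"] by (simp add: dvd_smult)
  then show ?case
    using Suc by (simp add: AB dvd_diff dvd_add dvd_smult del: smult_pCons)
qed (simp add: dvd_smult)

text \<open>At the point \<open>z = 1 / w\<close> each diagonal factor is the identity, so only the
  \<open>k + 1\<close> rotations remain and their angles add up.\<close>

lemma rotor_poly:
  assumes "w * z = 1"
  shows "poly (fst (rotor \<alpha> w P k)) z = cos (of_real (real (Suc k) * \<alpha>)) * poly P z \<and>
         poly (snd (rotor \<alpha> w P k)) z = sin (of_real (real (Suc k) * \<alpha>)) * poly P z"
proof (induction k)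
  case (Suc k)
  obtain A B where AB: "rotor \<alpha> w P k = (A, B)" by (cases "rotor \<alpha> w P k")
  define \<theta> where "\<theta> = complex_of_real (real (Suc k) * \<alpha>)"
  have zw: "z * (w * x) = x" for x
    using assms by (metis mult.assoc mult.commute mult_1)
  have "complex_of_real (real (Suc (Suc k)) * \<alpha>) = \<theta> + of_real \<alpha>"
    by (simp add: \<theta>_def algebra_simps)
  moreover have "poly A z = cos \<theta> * poly P z" "poly B z = sin \<theta> * poly P z"
    using Suc by (simp_all only: AB \<theta>_def fst_conv snd_conv)
  ultimately show ?case
    by (simp only: rotor.simps AB case_prod_conv fst_conv snd_conv poly_diff poly_add poly_smult
        poly_pCons cos_add sin_add zw) (simp add: algebra_simps)
qed simp

text \<open>At 0 the diagonal factor kills the second component, so each step contributes one more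
  factor cos \<alpha>.\<close>

lemma rotor_coeff_0: "coeff (fst (rotor \<alpha> w P k)) 0 = cos (of_real \<alpha>) ^ Suc k * coeff P 0"
proof (induction k)
  case (Suc k)
  obtain A B where AB: "rotor \<alpha> w P k = (A, B)" by (cases "rotor \<alpha> w P k")
  show ?case using Suc by (simp add: AB)
qed simp

text \<open>Shifting the coefficients and multiplying them by a unimodular \<open>w\<close>
  preserves the sum of squares, and the rotation acts on each pair of coefficients by
  \<open>norm_rotation\<close>.\<close>

lemma rotor_norm:
  assumes "degree P \<le> d" "cmod w = 1"
  shows "(\<Sum>i\<le>d + k. (cmod (coeff (fst (rotor \<alpha> w P k)) i))\<^sup>2 + (cmod (coeff (snd (rotor \<alpha> w P k)) i))\<^sup>2)
    = (\<Sum>i\<le>d. (cmod (coeff P i))\<^sup>2)"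
proof (induction k)
  case 0
  show ?case using norm_rotation[of \<alpha> "coeff P _" 0] by simp
next
  case (Suc k)
  obtain A B where AB: "rotor \<alpha> w P k = (A, B)" by (cases "rotor \<alpha> w P k")
  \<comment> \<open>The shifted \<open>B\<close> reaches degree \<open>d + Suc k\<close>; the extra
    index adds nothing for \<open>A\<close>.\<close>
  have A: "coeff A (d + Suc k) = 0"
    using rotor_degree[OF assms(1), of \<alpha> w k] AB by (simp add: coeff_eq_0)
  define B' where "B' = pCons 0 (smult w B)"
  have "(\<Sum>i\<le>d + Suc k. (cmod (coeff B' i))\<^sup>2) = (\<Sum>i\<le>d + k. (cmod (coeff B' (Suc i)))\<^sup>2)"
    unfolding add_Suc_right sum.atMost_Suc_shift by (simp add: B'_def)
  also have "\<dots> = (\<Sum>i\<le>d + k. (cmod (coeff B i))\<^sup>2)"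
    by (simp add: B'_def norm_mult assms(2))
  finally have "(\<Sum>i\<le>d + Suc k. (cmod (coeff A i))\<^sup>2 + (cmod (coeff B' i))\<^sup>2)
      = (\<Sum>i\<le>d + k. (cmod (coeff A i))\<^sup>2 + (cmod (coeff B i))\<^sup>2)"
    using A by (simp add: sum.distrib)
  also have "\<dots> = (\<Sum>i\<le>d. (cmod (coeff P i))\<^sup>2)"
    using Suc by (simp only: AB fst_conv snd_conv)
  finally show ?case
    by (simp only: rotor.simps AB case_prod_conv fst_conv snd_conv coeff_diff coeff_add coeff_smult
        norm_rotation flip: B'_def)
qed

section \<open>Polynomials with prescribed zeros on the unit circle and a large constant
  coefficient\<close>

text \<open>With \<open>w = inverse z\<close>, the \<open>N + 1\<close> rotations by ?\<alpha> add
  up to a right angle at \<open>z\<close>, so the first component acquires the factor cos (pi / 2) =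
  0 there. Discarding the second component can only lower the norm.\<close>

lemma annihilate_point:
  fixes P :: "complex poly"
  assumes "degree P \<le> d" "cmod z = 1"
  obtains A where "degree A \<le> d + N" "P dvd A" "poly A z = 0"
    "coeff A 0 = of_real (cos (pi / (2 * real (Suc N))) ^ Suc N) * coeff P 0"
    "(\<Sum>i\<le>d + N. (cmod (coeff A i))\<^sup>2) \<le> (\<Sum>i\<le>d. (cmod (coeff P i))\<^sup>2)"
proof
  let ?\<alpha> = "pi / (2 * real (Suc N))"
  let ?V = "rotor ?\<alpha> (inverse z) P N"
  have z: "inverse z * z = 1" "cmod (inverse z) = 1"
    using assms(2) by (auto simp: norm_inverse intro!: left_inverse)
  have "real (Suc N) * ?\<alpha> = pi / 2" by (simp add: field_simps)
  then show "poly (fst ?V) z = 0"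
    using rotor_poly[OF z(1), of ?\<alpha> P N] by (simp only: cos_of_real) simp
  show "degree (fst ?V) \<le> d + N" using rotor_degree[OF assms(1)] by simp
  show "P dvd fst ?V" using rotor_dvd by simp
  show "coeff (fst ?V) 0 = of_real (cos ?\<alpha> ^ Suc N) * coeff P 0"
    unfolding rotor_coeff_0 cos_of_real by simp
  show "(\<Sum>i\<le>d + N. (cmod (coeff (fst ?V) i))\<^sup>2) \<le> (\<Sum>i\<le>d. (cmod (coeff P i))\<^sup>2)"
    unfolding rotor_norm[OF assms(1) z(2), of ?\<alpha> N, symmetric] by (intro sum_mono) simp
qed

text \<open>Starting from the polynomial 1, each point costs degree \<open>N\<close> and one factor
  in the constant coefficient, while the sum of squares never grows.\<close>

lemma annihilate_points:
  fixes z :: "nat \<Rightarrow> complex"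
  assumes "\<And>j. j < n \<Longrightarrow> cmod (z j) = 1"
  obtains P where "degree P \<le> n * N" "\<And>j. j < n \<Longrightarrow> poly P (z j) = 0"
    "coeff P 0 = of_real (cos (pi / (2 * real (Suc N))) ^ (Suc N * n))"
    "(\<Sum>i\<le>n * N. (cmod (coeff P i))\<^sup>2) \<le> 1"
  using assms
proof (induction n arbitrary: thesis)
  case 0
  show ?case by (rule 0(1)[of 1]) auto
next
  case (Suc n)
  obtain P where P: "degree P \<le> n * N" "\<And>j. j < n \<Longrightarrow> poly P (z j) = 0"
    "coeff P 0 = of_real (cos (pi / (2 * real (Suc N))) ^ (Suc N * n))"
    "(\<Sum>i\<le>n * N. (cmod (coeff P i))\<^sup>2) \<le> 1"
    using Suc.IH Suc.prems(2) by (metis less_Suc_eq)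
  obtain A where A: "degree A \<le> n * N + N" "P dvd A" "poly A (z n) = 0"
    "coeff A 0 = of_real (cos (pi / (2 * real (Suc N))) ^ Suc N) * coeff P 0"
    "(\<Sum>i\<le>n * N + N. (cmod (coeff A i))\<^sup>2) \<le> (\<Sum>i\<le>n * N. (cmod (coeff P i))\<^sup>2)"
    using annihilate_point[OF P(1) Suc.prems(2)[of n], of N] by blast
  have eq: "Suc n * N = n * N + N" by simp
  show ?case
  proof (rule Suc.prems(1)[of A], unfold eq)
    show "poly A (z j) = 0" if "j < Suc n" for j
      using that A(2,3) P(2)[of j] by (auto simp: less_Suc_eq elim!: dvdE)
    show "coeff A 0 = of_real (cos (pi / (2 * real (Suc N))) ^ (Suc N * Suc n))"
      unfolding A(4) P(3) of_real_mult[symmetric] power_add[symmetric] by simp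
  qed (use A P in auto)
qed

text \<open>The coefficients of a polynomial vanishing at all \<open>z j\<close> form a linear
  relation between the values \<open>x k\<close>; solving it for \<open>x 0\<close> and applying
  Cauchy-Schwarz gives the bound.\<close>

lemma power_sum_bound:
  fixes a z :: "nat \<Rightarrow> complex" and N n :: nat
  assumes z: "\<And>j. j < n \<Longrightarrow> cmod (z j) = 1"
  defines "x \<equiv> \<lambda>k. \<Sum>j<n. a j * z j ^ k"
    and "\<delta> \<equiv> cos (pi / (2 * real (Suc N))) ^ (Suc N * n)"
  shows "\<delta>\<^sup>2 * (cmod (x 0))\<^sup>2 \<le> (1 - \<delta>\<^sup>2) * (\<Sum>k=1..n * N. (cmod (x k))\<^sup>2)"
proof -
  obtain P where P: "degree P \<le> n * N" "\<And>j. j < n \<Longrightarrow> poly P (z j) = 0"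
    "coeff P 0 = of_real \<delta>" "(\<Sum>i\<le>n * N. (cmod (coeff P i))\<^sup>2) \<le> 1"
    by (rule annihilate_points[of n z N, OF z], assumption) (rule that, auto simp: \<delta>_def)
  have split: "sum g {..n * N} = g 0 + sum g {1..n * N}" for g :: "nat \<Rightarrow> 'b::comm_monoid_add"
  proof -
    have "{..n * N} = insert 0 {1..n * N}" by auto
    then show ?thesis by simp
  qed
  have "(\<Sum>k\<le>n * N. coeff P k * x k) = (\<Sum>j<n. a j * (\<Sum>k\<le>n * N. coeff P k * z j ^ k))"
    unfolding x_def sum_distrib_left by (subst sum.swap) (simp add: mult_ac)
  also have "\<dots> = (\<Sum>j<n. a j * poly P (z j))"
    using P(1) unfolding poly_altdef
    by (intro sum.cong arg_cong2[where f = "(*)"] refl sum.mono_neutral_right) (auto simp: coeff_eq_0)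
  finally have "(\<Sum>k\<le>n * N. coeff P k * x k) = 0" using P(2) by simp
  then have "of_real \<delta> * x 0 = - (\<Sum>k=1..n * N. coeff P k * x k)"
    unfolding split P(3) by (simp add: eq_neg_iff_add_eq_0)
  then have "\<bar>\<delta>\<bar> * cmod (x 0) = cmod (\<Sum>k=1..n * N. coeff P k * x k)"
    by (metis norm_minus_cancel norm_mult norm_of_real)
  also have "\<dots> \<le> (\<Sum>k=1..n * N. cmod (coeff P k) * cmod (x k))"
    by (rule sum_norm_le) (simp add: norm_mult)
  finally have "(\<bar>\<delta>\<bar> * cmod (x 0))\<^sup>2 \<le> (\<Sum>k=1..n * N. cmod (coeff P k) * cmod (x k))\<^sup>2"
    by (rule power_mono) simp
  also have "\<dots> \<le> (\<Sum>k=1..n * N. (cmod (coeff P k))\<^sup>2) * (\<Sum>k=1..n * N. (cmod (x k))\<^sup>2)"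
    by (rule Cauchy_Schwarz_ineq_sum)
  \<comment> \<open>The squares of all coefficients sum to at most 1, and the constant one uses up
    \<delta> squared of this.\<close>
  also have "\<dots> \<le> (1 - \<delta>\<^sup>2) * (\<Sum>k=1..n * N. (cmod (x k))\<^sup>2)"
    using P(4) by (intro mult_right_mono sum_nonneg) (auto simp: split P(3))
  finally show ?thesis by (simp add: power_mult_distrib)
qed

section \<open>Two limits: Riemann sums and the constant\<close>

text \<open>The integral telescopes over the cells; on each cell the mean value theorem for the
  antiderivative \<open>G\<close> turns the integral into a value of \<open>g\<close>, which uniform
  continuity compares with the value at the right endpoint.\<close>

lemma riemann_sum_tendsto_integral:
  fixes g :: "real \<Rightarrow> real"
  assumes "continuous_on {0..1} g"
  shows "(\<lambda>M. (\<Sum>k=1..M. g (real k / real M)) / real M) \<longlonglongrightarrow> integral {0..1} g"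
proof (rule LIMSEQ_I)
  fix e :: real assume e: "e > 0"
  have "uniformly_continuous_on {0..1} g"
    by (simp add: assms compact_uniformly_continuous)
  then obtain d where d: "d > 0"
    "\<And>x y. \<lbrakk>x \<in> {0..1}; y \<in> {0..1}; dist y x < d\<rbrakk> \<Longrightarrow> dist (g y) (g x) < e/2"
    using e half_gt_zero unfolding uniformly_continuous_on_def by metis
  define G where "G = (\<lambda>u. integral {0..u} g)"
  obtain M0 :: nat where M0: "M0 > 0" "1 / real M0 < d"
    using d(1) by (metis nat_approx_posE zero_less_Suc)
  show "\<exists>no. \<forall>M\<ge>no. norm ((\<Sum>k=1..M. g (real k / real M)) / real M - integral {0..1} g) < e"
  proof (intro exI allI impI)
    fix M assume M: "M \<ge> M0"
    then have Mpos: "M > 0" using M0 by simp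
    have "1 / real M \<le> 1 / real M0" using M M0 by (simp add: frac_le)
    then have Md: "1 / real M < d" using M0(2) by linarith
    have step: "\<bar>g (real (Suc k) / real M) / real M - (G (real (Suc k) / real M) - G (real k / real M))\<bar>
        \<le> e / 2 / real M" if k: "k < M" for k
    proof -
      let ?a = "real k / real M" and ?b = "real (Suc k) / real M"
      have ab: "0 \<le> ?a" "?a < ?b" "?b \<le> 1" "?b - ?a = 1 / real M"
        using k Mpos by (auto simp: field_simps)
      have "\<exists>x\<in>{?a<..<?b}. G ?b - G ?a = g x * (?b - ?a)"
      proof -
        have der: "(G has_derivative (\<lambda>y. y * g x)) (at x within {?a..?b})" if "x \<in> {?a..?b}" for x
        proof -
          have "(G has_real_derivative g x) (at x within {0..1})"
            unfolding G_def using order.trans[OF ab(1)] order.trans[OF _ ab(3)] that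
            by (intro integral_has_real_derivative assms) auto
          then have "(G has_real_derivative g x) (at x within {?a..?b})"
            by (rule DERIV_subset) (use ab in auto)
          then show ?thesis by (simp only: has_field_derivative_def mult.commute[of _ "g x"])
        qed
        obtain x where "x \<in> {?a<..<?b}" "G ?b - G ?a = (?b - ?a) * g x"
          using mvt_simple[OF ab(2), of G "\<lambda>x y. y * g x"] der by auto
        then show ?thesis by (auto simp: mult.commute)
      qed
      then obtain x where x: "?a < x" "x < ?b" "G ?b - G ?a = g x / real M"
        using ab(4) by auto
      have "dist (g ?b) (g x) < e / 2"
        using x ab(3,4) order.trans[OF ab(1), of x] Md by (intro d(2)) (auto simp: dist_real_def)
      then show ?thesis
        unfolding x(3) diff_divide_distrib[symmetric] abs_divide dist_real_def
        using e Mpos by (intro frac_le) auto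
    qed
    have "(\<Sum>k<M. G (real (Suc k) / real M) - G (real k / real M)) = G (real M / real M) - G (real 0 / real M)"
      by (rule sum_lessThan_telescope)
    also have "\<dots> = integral {0..1} g" using Mpos by (simp add: G_def)
    finally have tel: "integral {0..1} g = (\<Sum>k<M. G (real (Suc k) / real M) - G (real k / real M))" by simp
    have shift: "(\<Sum>k=1..M. g (real k / real M)) = (\<Sum>k<M. g (real (Suc k) / real M))"
      using sum.atLeast1_atMost_eq[of "\<lambda>k. g (real k / real M)" M] by simp
    have "\<bar>(\<Sum>k=1..M. g (real k / real M)) / real M - integral {0..1} g\<bar>
       = \<bar>\<Sum>k<M. g (real (Suc k) / real M) / real M - (G (real (Suc k) / real M) - G (real k / real M))\<bar>"
      unfolding tel shift sum_divide_distrib sum_subtractf by simp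
    also have "\<dots> \<le> (\<Sum>k<M. e / 2 / real M)"
      using step by (intro order.trans[OF sum_abs] sum_mono) auto
    also have "\<dots> < e" using Mpos e by simp
    finally show "norm ((\<Sum>k=1..M. g (real k / real M)) / real M - integral {0..1} g) < e" by simp
  qed
qed

text \<open>With \<open>m = N + 1\<close> and \<open>h = pi / (2 * m)\<close>,
  \<open>- ln (cos h)\<close> behaves like \<open>h^2 / 2\<close>, so the bracket behaves like
  \<open>c * m * h^2 = c * pi^2 / (4 * m)\<close>; the factor \<open>c * N\<close> then yields the
  limit.\<close>

lemma cos_power_limit:
  fixes c :: real
  shows "(\<lambda>N. (1 / cos (pi / (2 * (real N + 1))) powr (2 * c * (real N + 1)) - 1) * (c * real N)) \<longlonglongrightarrow> (pi * c / 2)\<^sup>2"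
proof -
  have "(\<lambda>N. (1 / cos (pi / (2 * (real N + 1))) powr (2 * c * (real N + 1)) - 1) * (c * real N))
      \<longlonglongrightarrow> pi * (pi * c) * c / 4"
    by real_asymp
  then show ?thesis by (simp add: power2_eq_square mult_ac)
qed

section \<open>The pointwise bound for exponential sums\<close>

text \<open>Coefficients and frequencies are explicit and the frequencies come in any order, which
  makes the form stable under affine substitutions, including those that reverse direction.\<close>

definition exp_sum :: "nat \<Rightarrow> (nat \<Rightarrow> complex) \<Rightarrow> (nat \<Rightarrow> real) \<Rightarrow> real \<Rightarrow> complex" where
  "exp_sum n a l t = (\<Sum>j<n. a j * exp (\<i> * of_real (l j * t)))"

lemma continuous_on_exp_sum [continuous_intros]: "continuous_on A (exp_sum n a l)"
  unfolding exp_sum_def by (intro continuous_intros)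

lemma exp_sum_affine:
  "exp_sum n a l (y + c * t) = exp_sum n (\<lambda>j. a j * exp (\<i> * of_real (l j * y))) (\<lambda>j. l j * c) t"
  unfolding exp_sum_def by (intro sum.cong refl) (simp add: algebra_simps exp_add)

text \<open>\<open>power_sum_bound\<close> is applied to the samples at \<open>k / (n * N)\<close>
  and divided by \<delta> squared; as \<open>N\<close> grows, the mean of the squared samples tends
  to the integral and the remaining factor \<open>K N\<close> to the constant.\<close>

lemma exp_sum_endpoint_bound:
  assumes "n \<ge> 1"
  shows "(cmod (exp_sum n a l 0))\<^sup>2 \<le> (pi * real n / 2)\<^sup>2 * integral {0..1} (\<lambda>t. (cmod (exp_sum n a l t))\<^sup>2)"
proof -
  let ?f = "exp_sum n a l"
  define S where "S = (\<lambda>M. (\<Sum>k=1..M. (cmod (?f (real k / real M)))\<^sup>2) / real M)"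
  define K where "K = (\<lambda>N. (1 / cos (pi / (2 * (real N + 1))) powr (2 * real n * (real N + 1)) - 1) * (real n * real N))"
  have "S \<longlonglongrightarrow> integral {0..1} (\<lambda>t. (cmod (?f t))\<^sup>2)"
    unfolding S_def by (intro riemann_sum_tendsto_integral continuous_intros)
  moreover have "strict_mono (\<lambda>N. n * N)"
    using assms by (simp add: strict_mono_def)
  ultimately have "(\<lambda>N. S (n * N)) \<longlonglongrightarrow> integral {0..1} (\<lambda>t. (cmod (?f t))\<^sup>2)"
    using LIMSEQ_subseq_LIMSEQ[of S _ "\<lambda>N. n * N"] by (simp add: o_def)
  then have lim: "(\<lambda>N. K N * S (n * N)) \<longlonglongrightarrow> (pi * real n / 2)\<^sup>2 * integral {0..1} (\<lambda>t. (cmod (?f t))\<^sup>2)"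
    unfolding K_def by (intro tendsto_mult cos_power_limit)
  \<comment> \<open>For \<open>N = 0\<close> the angle would be a right one and \<beta> would
    vanish.\<close>
  have "(cmod (?f 0))\<^sup>2 \<le> K N * S (n * N)" if "N \<ge> 1" for N
  proof -
    define \<beta> where "\<beta> = cos (pi / (2 * real (Suc N)))"
    define \<delta> where "\<delta> = \<beta> ^ (Suc N * n)"
    define \<Sigma> where "\<Sigma> = (\<Sum>k=1..n * N. (cmod (?f (real k / real (n * N))))\<^sup>2)"
    have "pi / (2 * real (Suc N)) < pi / 2"
      using that by (intro divide_strict_left_mono) auto
    moreover have "0 < pi / (2 * real (Suc N))" by simp
    ultimately have \<beta>: "\<beta> > 0"
      unfolding \<beta>_def by (intro cos_gt_zero)
    then have \<delta>: "\<delta> > 0" by (simp add: \<delta>_def)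
    \<comment> \<open>The factor each exponential gains over one sampling step, so that its powers
      give the samples.\<close>
    define z where "z = (\<lambda>j. exp (\<i> * of_real (l j / real (n * N))))"
    have x: "(\<Sum>j<n. a j * z j ^ k) = ?f (real k / real (n * N))" for k
      unfolding z_def exp_sum_def exp_of_nat_mult[symmetric]
      by (intro sum.cong refl) (simp add: mult_ac)
    have "\<delta>\<^sup>2 * (cmod (\<Sum>j<n. a j * z j ^ 0))\<^sup>2 \<le> (1 - \<delta>\<^sup>2) * (\<Sum>k=1..n * N. (cmod (\<Sum>j<n. a j * z j ^ k))\<^sup>2)"
      unfolding \<delta>_def \<beta>_def by (rule power_sum_bound) (simp add: z_def)
    then have "(cmod (?f 0))\<^sup>2 \<le> (1 / \<delta>\<^sup>2 - 1) * \<Sigma>"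
      using \<delta> unfolding x \<Sigma>_def by (simp add: field_simps)
    also have "\<dots> = (1 / \<delta>\<^sup>2 - 1) * (real n * real N) * (\<Sigma> / (real n * real N))"
      using that assms by simp
    also have "\<delta>\<^sup>2 = \<beta> powr (2 * real n * (real N + 1))"
    proof -
      have "\<delta>\<^sup>2 = \<beta> ^ (2 * n * (N + 1))"
        by (simp add: \<delta>_def mult_ac flip: power_mult)
      also have "\<dots> = \<beta> powr real (2 * n * (N + 1))"
        using \<beta> by (rule powr_realpow[symmetric])
      finally show ?thesis by (simp add: algebra_simps)
    qed
    finally show ?thesis
      by (simp add: K_def S_def \<Sigma>_def \<beta>_def add.commute)
  qed
  then show ?thesis
    by (intro LIMSEQ_le_const[OF lim]) blast
qed

text \<open>The point \<open>y\<close> is an endpoint of both \<open>{y..1}\<close> and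
  \<open>{0..y}\<close>. The endpoint bound rescaled to these intervals carries the weights
  \<open>1 - y\<close> and \<open>y\<close>, which add up to 1.\<close>

lemma exp_sum_pointwise_bound:
  assumes "n \<ge> 1" and y: "y \<in> {0..1}"
  shows "(cmod (exp_sum n a l y))\<^sup>2 \<le> (pi * real n / 2)\<^sup>2 * integral {0..1} (\<lambda>t. (cmod (exp_sum n a l t))\<^sup>2)"
proof -
  let ?C = "(pi * real n / 2)\<^sup>2"
  define g where "g = (\<lambda>t. (cmod (exp_sum n a l t))\<^sup>2)"
  have cont: "continuous_on A g" for A
    unfolding g_def by (intro continuous_intros)
  have scaled: "g y \<le> ?C * integral {0..1} (\<lambda>t. g (c * t + y))" for c
    using exp_sum_endpoint_bound[OF assms(1), of "\<lambda>j. a j * exp (\<i> * of_real (l j * y))" "\<lambda>j. l j * c"]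
    unfolding exp_sum_affine[symmetric] by (simp add: g_def add.commute)
  have affine: "((\<lambda>t. g (c * t + y)) has_integral integral {u..v} g / \<bar>c\<bar>) ((\<lambda>x. x / c - y / c) ` {u..v})"
    if "c \<noteq> 0" for c u v
  proof -
    have "(g has_integral integral {u..v} g) (cbox u v)"
      using integrable_integral[OF integrable_continuous_real[OF cont]] by simp
    from has_integral_affinity[OF this that, of y] show ?thesis by simp
  qed
  have right: "(1 - y) * g y \<le> ?C * integral {y..1} g"
  proof (cases "y = 1")
    case False
    then have "1 - y > 0" using y by auto
    have "1 / (1 - y) - y / (1 - y) = 1" using \<open>1 - y > 0\<close> by (simp flip: diff_divide_distrib)
    then have "(\<lambda>x. x / (1 - y) - y / (1 - y)) ` {y..1} = {0..1}"
      using y image_affinity_atLeastAtMost_div_diff[of "1 - y" "y / (1 - y)" y 1] by simp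
    then have "integral {0..1} (\<lambda>t. g ((1 - y) * t + y)) = integral {y..1} g / (1 - y)"
      using affine[of "1 - y" y 1] \<open>1 - y > 0\<close> by (intro integral_unique) simp
    then have "integral {y..1} g = (1 - y) * integral {0..1} (\<lambda>t. g ((1 - y) * t + y))"
      using \<open>1 - y > 0\<close> by simp
    then show ?thesis
      using mult_left_mono[OF scaled[of "1 - y"], of "1 - y"] \<open>1 - y > 0\<close> by (simp add: mult.left_commute)
  qed simp
  \<comment> \<open>Here \<open>c = - y\<close> runs through the interval backwards, starting at
    \<open>y\<close>.\<close>
  have left: "y * g y \<le> ?C * integral {0..y} g"
  proof (cases "y = 0")
    case False
    then have "y > 0" using y by auto
    have "(\<lambda>x. x / (- y) - y / (- y)) ` {0..y} = {0..1}"
      unfolding image_affinity_atLeastAtMost_div_diff using \<open>y > 0\<close> by simp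
    then have "integral {0..1} (\<lambda>t. g (- y * t + y)) = integral {0..y} g / y"
      using affine[of "- y" 0 y] \<open>y > 0\<close> by (intro integral_unique) simp
    then have "integral {0..y} g = y * integral {0..1} (\<lambda>t. g (- y * t + y))"
      using \<open>y > 0\<close> by simp
    then show ?thesis
      using mult_left_mono[OF scaled[of "- y"], of y] \<open>y > 0\<close> by (simp add: mult.left_commute)
  qed simp
  have "integral {0..y} g + integral {y..1} g = integral {0..1} g"
    using y by (intro Henstock_Kurzweil_Integration.integral_combine integrable_continuous_real cont) auto
  then have "?C * integral {0..1} g = ?C * integral {0..y} g + ?C * integral {y..1} g"
    by (simp only: flip: distrib_left)
  moreover have "g y = (1 - y) * g y + y * g y" by (simp add: algebra_simps)
  ultimately have "g y \<le> ?C * integral {0..1} g" using left right by linarith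
  then show ?thesis unfolding g_def .
qed

section \<open>From the pointwise bound to the norm inequality\<close>

text \<open>Passes from the Lebesgue interval integral to the gauge integral used elsewhere.\<close>

lemma Lr_norm01_eq:
  assumes "continuous_on {0..1} f" "r > 0"
  shows "Lr_norm01 r f = integral {0..1} (\<lambda>t. norm (f t) powr r) powr (1 / r)"
proof -
  have "continuous_on {0..1} (\<lambda>t. norm (f t) powr r)"
    using assms by (intro continuous_on_powr' continuous_intros) auto
  from interval_integral_eq_integral[OF _ borel_integrable_atLeastAtMost'[OF this]]
  show ?thesis by (simp add: Lr_norm01_def zero_ereal_def one_ereal_def)
qed

theorem theorem2p5:
  fixes q :: real and p :: ereal and n :: nat and f :: "real \<Rightarrow> complex"
  assumes "0 < q" and "ereal q < p" and "q \<le> 2"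
    and "n \<ge> 1" and "f \<in> exp_sums n"
  shows "Lp_norm01 p f \<le> (pi * real n / 2) powr (2 / q - 2 * inv_exp p) * Lr_norm01 q f"
proof -
  obtain a l where f: "f = exp_sum n a l"
    using assms(5) unfolding exp_sums_def exp_sum_def by blast
  define C where "C = pi * real n / 2"
  define S where "S = Linf_norm01 f"
  define I where "I = (\<lambda>r. integral {0..1} (\<lambda>t. norm (f t) powr r))"
  have C: "C > 0" using assms(4) by (simp add: C_def)
  have contf: "continuous_on {0..1} f" unfolding f by (rule continuous_on_exp_sum)
  have cont: "continuous_on {0..1} (\<lambda>t. norm (f t) powr r)" if "r > 0" for r
    using contf that by (intro continuous_on_powr' continuous_intros) auto
  have "compact ((\<lambda>t. norm (f t)) ` {0..1})"
    by (intro compact_continuous_image continuous_intros contf) simp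
  then have "bdd_above ((\<lambda>t. norm (f t)) ` {0..1})"
    by (intro bounded_imp_bdd_above compact_imp_bounded)
  then have le_S: "norm (f t) \<le> S" if "t \<in> {0..1}" for t
    unfolding S_def Linf_norm01_def using that by (intro cSUP_upper)
  then have S0: "S \<ge> 0" using norm_ge_zero order.trans by (metis atLeastAtMost_iff order.refl zero_le_one)
  have I0: "I r \<ge> 0" if "r > 0" for r
    unfolding I_def by (intro integral_nonneg integrable_continuous_real cont that) simp
  have Lr: "Lr_norm01 r f = I r powr (1 / r)" if "r > 0" for r
    unfolding I_def by (rule Lr_norm01_eq[OF contf that])
  show ?thesis
  \<comment> \<open>If \<open>S = 0\<close>, then \<open>f\<close> vanishes on the unit interval;
    otherwise powers of \<open>S\<close> can be cancelled.\<close>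
  proof (cases "S = 0")
    case True
    have z: "norm (f t) = 0" if "t \<in> {0..1}" for t
      using le_S[OF that] True by simp
    have "Lp_norm01 p f = 0"
    proof (cases p)
      case (real r)
      then have r: "r > 0" using assms by simp
      have "I r = integral {0..1} (\<lambda>t::real. 0 :: real)"
        unfolding I_def by (intro Henstock_Kurzweil_Integration.integral_cong) (simp add: z del: norm_eq_zero)
      then show ?thesis using Lr[OF r] real by (simp add: Lp_norm01_def)
    qed (use assms True in \<open>auto simp: Lp_norm01_def S_def\<close>)
    then show ?thesis by (simp add: Lr_norm01_def)
  next
    case False
    then have S: "S > 0" using S0 by simp
    have interp: "I r \<le> S powr (r - q) * I q" if "r \<ge> q" for r
    proof -
      have "norm (f t) powr r \<le> S powr (r - q) * norm (f t) powr q" if "t \<in> {0..1}" for t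
      proof (cases "f t = 0")
        case False
        have "norm (f t) powr r = norm (f t) powr (r - q) * norm (f t) powr q"
          by (simp flip: powr_add)
        also have "\<dots> \<le> S powr (r - q) * norm (f t) powr q"
          using le_S[OF that] \<open>r \<ge> q\<close> by (intro mult_right_mono powr_mono2) auto
        finally show ?thesis .
      qed simp
      then have "I r \<le> integral {0..1} (\<lambda>t. S powr (r - q) * norm (f t) powr q)"
        unfolding I_def using that assms(1)
        by (intro integral_le integrable_continuous_real continuous_intros cont) auto
      then show ?thesis by (simp add: I_def)
    qed
    have I2: "I 2 = integral {0..1} (\<lambda>t. (norm (f t))\<^sup>2)"
      unfolding I_def by (intro Henstock_Kurzweil_Integration.integral_cong) simp
    have "S \<le> sqrt (C\<^sup>2 * I 2)"
      unfolding S_def Linf_norm01_def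
      by (intro cSUP_least real_le_rsqrt)
        (use exp_sum_pointwise_bound[OF assms(4)] in \<open>auto simp: f I2 C_def\<close>)
    then have "S\<^sup>2 \<le> C\<^sup>2 * I 2"
      using S I0[of 2] by (metis order.strict_implies_order real_sqrt_pow2 power_mono zero_le_mult_iff
          zero_le_power2 zero_less_numeral)
    also have "\<dots> \<le> C\<^sup>2 * (S powr (2 - q) * I q)"
      using interp[OF assms(3)] by (intro mult_left_mono) auto
    \<comment> \<open>Splitting off the power \<open>2 - q\<close> lets it cancel against the same
      factor on the right, leaving a bound by the integral with exponent \<open>q\<close>.\<close>
    also have "S\<^sup>2 = S powr (2 - q) * S powr q"
      using S by (simp flip: powr_add)
    finally have "S powr q \<le> C\<^sup>2 * I q"
      using S by (simp add: mult.left_commute[of "C\<^sup>2"])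
    then have "(S powr q) powr (1 / q) \<le> (C\<^sup>2 * I q) powr (1 / q)"
      using assms(1) by (intro powr_mono2) auto
    also have "(C\<^sup>2 * I q) powr (1 / q) = (C powr 2) powr (1 / q) * I q powr (1 / q)"
      using C I0[OF assms(1)] by (subst powr_mult) auto
    finally have sup: "S \<le> C powr (2 / q) * I q powr (1 / q)"
      using assms(1) S by (simp add: powr_powr)
    show ?thesis
    proof (cases p)
      case (real r)
      then have r: "r > 0" "r > q" using assms by auto
      have Iq: "I q > 0" using sup S I0[OF assms(1)] by (cases "I q = 0") auto
      have "Lp_norm01 p f = I r powr (1 / r)"
        using real by (simp add: Lp_norm01_def Lr[OF r(1)])
      also have "\<dots> \<le> (S powr (r - q) * I q) powr (1 / r)"
        using interp[of r] r I0 by (intro powr_mono2) auto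
      also have "\<dots> = S powr ((r - q) / r) * I q powr (1 / r)"
        using Iq S by (simp add: powr_mult powr_powr)
      \<comment> \<open>Inserting \<open>sup\<close> for \<open>S\<close>; the exponents then
        collect to \<open>2 / q - 2 / r\<close> for \<open>C\<close> and \<open>1 / q\<close> for
        \<open>I q\<close>.\<close>
      also have "\<dots> \<le> (C powr (2 / q) * I q powr (1 / q)) powr ((r - q) / r) * I q powr (1 / r)"
        using sup S r by (intro mult_right_mono powr_mono2) auto
      also have "\<dots> = C powr (2 / q * ((r - q) / r)) * I q powr (1 / q * ((r - q) / r) + 1 / r)"
        by (simp add: powr_mult powr_powr powr_add)
      also have "2 / q * ((r - q) / r) = 2 / q - 2 * inv_exp p"
        using r assms(1) real by (simp add: inv_exp_def field_simps)
      also have "1 / q * ((r - q) / r) + 1 / r = 1 / q"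
        using r assms(1) by (simp add: field_simps)
      finally show ?thesis by (simp add: Lr[OF assms(1)] C_def)
    next
      case PInf
      then show ?thesis
        using sup by (simp add: Lp_norm01_def inv_exp_def Lr[OF assms(1)] C_def S_def)
    qed (use assms in auto)
  qed
qed

end
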